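(* Let $X,Y$ be complex Banach spaces, let $A\in\mathcal{L}(X,Y)$ and $B,C\in\mathcal{L}(Y,X)$ be such that $A(BA)^2=ABACA=ACABA=(AC)^2A$, and let $\lambda\in\mathbb{C}$. Then $AC$ has the SVEP at $\lambda$ if and only if $BA$ has the SVEP at $\lambda$. In particular, $AC$ has the SVEP if and only if $BA$ has the SVEP.
   Context: $\mathcal{L}(X,Y)$ is the set of bounded linear operators from $X$ to $Y$, and $\mathcal{L}(X)=\mathcal{L}(X,X)$. An operator $T\in\mathcal{L}(X)$ has the single valued extension property (SVEP) at $\lambda\in\mathbb{C}$ if there is an open disc $V$ centered at $\lambda$ such that for every open subset $U\subset V$, the only analytic function $f:U\to X$ with $(T-\mu)f(\mu)=0$ for all $\mu\in U$ is $f\equiv 0$. $T$ has the SVEP if it has the SVEP at every $\lambda\in\mathbb{C}$. *)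

theory Defs
  imports "HOL-Complex_Analysis.Complex_Analysis"
begin

text \<open>
  HOL-Analysis provides Banach spaces over the reals only. A complex normed space is a real normed
  space with a compatible multiplication by complex scalars for which the norm is homogeneous.
\<close>

class complex_normed_vector = real_normed_vector +
  fixes scaleC :: "complex \<Rightarrow> 'a \<Rightarrow> 'a"  (infixr "*\<^sub>C" 75)
  assumes scaleC_add_right: "a *\<^sub>C (x + y) = a *\<^sub>C x + a *\<^sub>C y"
    and scaleC_add_left: "(a + b) *\<^sub>C x = a *\<^sub>C x + b *\<^sub>C x"
    and scaleC_scaleC: "a *\<^sub>C (b *\<^sub>C x) = (a * b) *\<^sub>C x"
    and scaleC_of_real: "complex_of_real r *\<^sub>C x = r *\<^sub>R x"
    and norm_scaleC: "norm (a *\<^sub>C x) = cmod a * norm x"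

class complex_banach = complex_normed_vector + complete_space

subclass (in complex_banach) banach ..

instantiation complex :: complex_banach
begin

definition scaleC_complex :: "complex \<Rightarrow> complex \<Rightarrow> complex" where
  "scaleC_complex a x = a * x"

instance
  by standard (simp_all add: scaleC_complex_def algebra_simps scaleR_conv_of_real norm_mult)

end

definition bounded_clinear ::
    "('a::complex_normed_vector \<Rightarrow> 'b::complex_normed_vector) \<Rightarrow> bool" where
  "bounded_clinear T \<longleftrightarrow> bounded_linear T \<and> (\<forall>c x. T (c *\<^sub>C x) = c *\<^sub>C T x)"

text \<open>
  As for \<open>analytic_on\<close> in the complex analysis library, analyticity means complex
  differentiability (here in the norm of the target space) in a neighbourhood of every point.
\<close>

definition vec_analytic_on ::
    "(complex \<Rightarrow> 'a::complex_normed_vector) \<Rightarrow> complex set \<Rightarrow> bool"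
    (infixl "vec'_analytic'_on" 50) where
  "f vec_analytic_on S \<longleftrightarrow>
     (\<forall>z\<in>S. \<exists>e>0. \<forall>w\<in>ball z e. \<exists>D. (f has_derivative (\<lambda>h. h *\<^sub>C D)) (at w))"

lemma vec_analytic_on_complex_iff:
  fixes f :: "complex \<Rightarrow> complex"
  shows "f vec_analytic_on S \<longleftrightarrow> f analytic_on S"
proof -
  have "(\<exists>D. (f has_derivative (\<lambda>h. h *\<^sub>C D)) (at w)) \<longleftrightarrow> f field_differentiable at w" for w
  proof -
    have "(\<lambda>h. h *\<^sub>C D) = (*) D" for D :: complex
      by (rule ext) (simp only: scaleC_complex_def mult.commute[of D])
    then show ?thesis
      unfolding field_differentiable_def has_field_derivative_def by simp
  qed
  moreover have "f holomorphic_on ball z e \<longleftrightarrow> (\<forall>w\<in>ball z e. f field_differentiable at w)" for z e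
    by (simp add: holomorphic_on_open field_differentiable_def)
  ultimately show ?thesis
    unfolding vec_analytic_on_def analytic_on_def by simp
qed

text \<open>
  A function on \<open>U\<close> is represented by a total function of which only the values on \<open>U\<close> matter;
  \<open>U\<close> being open, analyticity on \<open>U\<close> depends on those values alone.
\<close>

definition SVEP_at :: "('a::complex_normed_vector \<Rightarrow> 'a) \<Rightarrow> complex \<Rightarrow> bool" where
  "SVEP_at T z \<longleftrightarrow>
     (\<exists>r>0. \<forall>U. open U \<and> U \<subseteq> ball z r \<longrightarrow>
        (\<forall>f. f vec_analytic_on U \<and> (\<forall>\<mu>\<in>U. T (f \<mu>) - \<mu> *\<^sub>C f \<mu> = 0) \<longrightarrow> (\<forall>\<mu>\<in>U. f \<mu> = 0)))"

definition SVEP :: "('a::complex_normed_vector \<Rightarrow> 'a) \<Rightarrow> bool" where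
  "SVEP T \<longleftrightarrow> (\<forall>z. SVEP_at T z)"

end

theory Submission
  imports Defs
begin

text \<open>
  A failure of the SVEP for \<open>T\<close> is witnessed by analytic families \<open>f \<noteq> 0\<close> with \<open>T (f \<mu>) = \<mu> f \<mu>\<close>, that
  is, by eigenvectors (possibly zero for some \<open>\<mu>\<close>) that depend analytically on the eigenvalue.
  A fixed bounded operator \<open>P\<close> that sends eigenvectors of \<open>T\<close> to eigenvectors of \<open>S\<close> with the same eigenvalue turns a family for \<open>T\<close> into a family \<open>P \<circ> f\<close> for \<open>S\<close>. If \<open>P\<close> is
  moreover injective on the eigenspaces with eigenvalue \<open>\<mu> \<noteq> 0\<close>, then \<open>P \<circ> f = 0\<close> forces \<open>f = 0\<close>
  away from \<open>0\<close>, and by continuity also at \<open>0\<close>. So the SVEP passes from \<open>S\<close> to \<open>T\<close>, with the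
  same disc; this is \<open>SVEP_at_transfer\<close>.

  The hypothesis says that the words \<open>ABABA\<close>, \<open>ABACA\<close>, \<open>ACABA\<close>, \<open>ACACA\<close> are the same operator,
  which supplies such a \<open>P\<close> in both directions.
  \<^item> If \<open>ACy = \<mu>y\<close>, take \<open>P = BACAC\<close>. Then \<open>Py = \<mu>\<^sup>2By\<close>, and \<open>APy = (ABACA)Cy = (ACACA)Cy = \<mu>\<^sup>3y\<close>.
    Hence \<open>BA(Py) = \<mu>\<^sup>3By = \<mu>Py\<close>, and \<open>Py = 0\<close> implies \<open>\<mu>\<^sup>3y = 0\<close>.
  \<^item> If \<open>BAx = \<mu>x\<close>, take \<open>P = ABA\<close>. Then \<open>AC(Px) = (ACABA)x = (ABABA)x = \<mu>Px\<close> and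
    \<open>BPx = \<mu>\<^sup>2x\<close>, so \<open>Px = 0\<close> implies \<open>\<mu>\<^sup>2x = 0\<close>.
\<close>

lemma scaleC_eq_0_iff: "c *\<^sub>C x = 0 \<longleftrightarrow> c = 0 \<or> x = 0"
  for x :: "'a::complex_normed_vector"
  by (metis mult_eq_0_iff norm_eq_zero norm_scaleC)

lemma scaleC_zero_right [simp]: "c *\<^sub>C (0 :: 'a::complex_normed_vector) = 0"
  by (simp add: scaleC_eq_0_iff)

lemma bounded_clinear_compose:
  assumes "bounded_clinear S" "bounded_clinear T"
  shows "bounded_clinear (S \<circ> T)"
  using assms bounded_linear_compose[of S T] unfolding bounded_clinear_def o_def by auto

lemma bounded_clinear_zero: "bounded_clinear T \<Longrightarrow> T 0 = 0"
  by (simp add: bounded_clinear_def bounded_linear.linear linear_0)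

lemma bounded_clinear_scaleC: "bounded_clinear T \<Longrightarrow> T (c *\<^sub>C x) = c *\<^sub>C T x"
  by (simp add: bounded_clinear_def)

lemma vec_analytic_on_bounded_clinear:
  assumes P: "bounded_clinear P" and f: "f vec_analytic_on U"
  shows "(P \<circ> f) vec_analytic_on U"
proof -
  have "\<exists>D'. ((P \<circ> f) has_derivative (\<lambda>h. h *\<^sub>C D')) (at w)"
    if "(f has_derivative (\<lambda>h. h *\<^sub>C D)) (at w)" for w D
  proof -
    have "((\<lambda>x. P (f x)) has_derivative (\<lambda>h. P (h *\<^sub>C D))) (at w)"
      using bounded_linear.has_derivative[of P, OF _ that] P by (simp add: bounded_clinear_def)
    then show ?thesis
      by (auto simp: o_def bounded_clinear_scaleC[OF P])
  qed
  then show ?thesis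
    using f unfolding vec_analytic_on_def by meson
qed

lemma vec_analytic_on_isCont:
  assumes "f vec_analytic_on U" "w \<in> U"
  shows "isCont f w"
  using assms unfolding vec_analytic_on_def
  by (meson centre_in_ball has_derivative_continuous)

lemma isCont_eq_0_if_punctured_eq_0:
  fixes f :: "complex \<Rightarrow> 'a::complex_normed_vector"
  assumes "isCont f w" "open U" "w \<in> U" and zero: "\<And>u. u \<in> U \<Longrightarrow> u \<noteq> w \<Longrightarrow> f u = 0"
  shows "f w = 0"
proof -
  have "eventually (\<lambda>u. f u = 0) (at w)"
    using assms by (auto simp: eventually_at_topological)
  then have "(f \<longlongrightarrow> 0) (at w)"
    by (rule tendsto_eventually)
  moreover have "(f \<longlongrightarrow> f w) (at w)"
    using assms(1) by (simp add: isCont_def)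
  ultimately show ?thesis
    using tendsto_unique trivial_limit_at by blast
qed

text \<open>
  Injectivity of \<open>P\<close> on the kernel of \<open>T\<close> cannot be asked for: the operators \<open>BACAC\<close> and \<open>ABA\<close> to
  which this is applied vanish on the kernels of \<open>AC\<close> and \<open>BA\<close>. The eigenvalue \<open>0\<close> can be left out because it is a single point of the parameter domain,
  and an analytic family is determined there by its values nearby.
\<close>

lemma SVEP_at_transfer:
  fixes T :: "'a::complex_normed_vector \<Rightarrow> 'a" and S :: "'b::complex_normed_vector \<Rightarrow> 'b"
  assumes P: "bounded_clinear P"
    and eigen: "\<And>\<mu> x. T x = \<mu> *\<^sub>C x \<Longrightarrow> S (P x) = \<mu> *\<^sub>C P x"
    and inj: "\<And>\<mu> x. T x = \<mu> *\<^sub>C x \<Longrightarrow> \<mu> \<noteq> 0 \<Longrightarrow> P x = 0 \<Longrightarrow> x = 0"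
    and S: "SVEP_at S z"
  shows "SVEP_at T z"
proof -
  obtain r where r: "r > 0"
    and uniq: "\<And>U g \<mu>. open U \<Longrightarrow> U \<subseteq> ball z r \<Longrightarrow> g vec_analytic_on U \<Longrightarrow>
      (\<And>\<nu>. \<nu> \<in> U \<Longrightarrow> S (g \<nu>) - \<nu> *\<^sub>C g \<nu> = 0) \<Longrightarrow> \<mu> \<in> U \<Longrightarrow> g \<mu> = 0"
    using S unfolding SVEP_at_def by metis
  have "\<forall>\<mu>\<in>U. f \<mu> = 0"
    if U: "open U" "U \<subseteq> ball z r" and f: "f vec_analytic_on U"
      and ker: "\<And>\<nu>. \<nu> \<in> U \<Longrightarrow> T (f \<nu>) - \<nu> *\<^sub>C f \<nu> = 0" for U f
  proof
    fix \<mu>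
    assume \<mu>: "\<mu> \<in> U"
    have T: "T (f \<nu>) = \<nu> *\<^sub>C f \<nu>" if "\<nu> \<in> U" for \<nu>
      using ker[OF that] by simp
    have "(P \<circ> f) \<nu> = 0" if "\<nu> \<in> U" for \<nu>
      using U vec_analytic_on_bounded_clinear[OF P f] _ that
      by (rule uniq) (simp add: eigen T)
    then have nonzero: "f \<nu> = 0" if "\<nu> \<in> U" "\<nu> \<noteq> 0" for \<nu>
      using inj[OF T] that by simp
    show "f \<mu> = 0"
    proof (cases "\<mu> = 0")
      case True
      then show ?thesis
        using isCont_eq_0_if_punctured_eq_0[OF vec_analytic_on_isCont[OF f \<mu>] U(1) \<mu>] nonzero
        by simp
    next
      case False
      then show ?thesis
        using nonzero \<mu> by simp
    qed
  qed
  then have "\<forall>U. open U \<and> U \<subseteq> ball z r \<longrightarrow>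
      (\<forall>f. f vec_analytic_on U \<and> (\<forall>\<mu>\<in>U. T (f \<mu>) - \<mu> *\<^sub>C f \<mu> = 0) \<longrightarrow> (\<forall>\<mu>\<in>U. f \<mu> = 0))"
    by (intro allI impI, elim conjE) (rule, auto)
  with r show ?thesis
    unfolding SVEP_at_def by (intro exI[of _ r] conjI)
qed

theorem proposition2p1:
  fixes A :: "'x::complex_banach \<Rightarrow> 'y::complex_banach"
    and B C :: "'y \<Rightarrow> 'x"
    and z :: complex
  assumes "bounded_clinear A" and "bounded_clinear B" and "bounded_clinear C"
    and "A \<circ> (B \<circ> A) ^^ 2 = A \<circ> B \<circ> A \<circ> C \<circ> A"
    and "A \<circ> B \<circ> A \<circ> C \<circ> A = A \<circ> C \<circ> A \<circ> B \<circ> A"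
    and "A \<circ> C \<circ> A \<circ> B \<circ> A = (A \<circ> C) ^^ 2 \<circ> A"
  shows "(SVEP_at (A \<circ> C) z \<longleftrightarrow> SVEP_at (B \<circ> A) z) \<and> (SVEP (A \<circ> C) \<longleftrightarrow> SVEP (B \<circ> A))"
proof -
  note lin = assms(1-3)
  note scale = lin[THEN bounded_clinear_scaleC]
  note zero = lin[THEN bounded_clinear_zero]
  have ABABA: "A (B (A (B (A x)))) = A (C (A (B (A x))))" for x
    using fun_cong[OF trans[OF assms(4,5)], of x] by (simp add: numeral_2_eq_2)
  have ABACA: "A (B (A (C (A x)))) = A (C (A (C (A x))))" for x
    using fun_cong[OF trans[OF assms(5,6)], of x] by (simp add: numeral_2_eq_2)

  have AC: "SVEP_at (A \<circ> C) w" if "SVEP_at (B \<circ> A) w" for w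
  proof (rule SVEP_at_transfer[where P = "B \<circ> A \<circ> C \<circ> A \<circ> C", OF _ _ _ that])
    show "bounded_clinear (B \<circ> A \<circ> C \<circ> A \<circ> C)"
      using lin by (intro bounded_clinear_compose)
  next
    fix \<mu> y
    assume "(A \<circ> C) y = \<mu> *\<^sub>C y"
    then have y: "A (C y) = \<mu> *\<^sub>C y"
      by simp
    then show "(B \<circ> A) ((B \<circ> A \<circ> C \<circ> A \<circ> C) y) = \<mu> *\<^sub>C (B \<circ> A \<circ> C \<circ> A \<circ> C) y"
      using ABACA[of "C y"] by (simp add: scale)
    assume "\<mu> \<noteq> 0" "(B \<circ> A \<circ> C \<circ> A \<circ> C) y = 0"
    then show "y = 0"
      using ABACA[of "C y"] y by (simp add: scale zero scaleC_eq_0_iff)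
  qed

  have BA: "SVEP_at (B \<circ> A) w" if "SVEP_at (A \<circ> C) w" for w
  proof (rule SVEP_at_transfer[where P = "A \<circ> B \<circ> A", OF _ _ _ that])
    show "bounded_clinear (A \<circ> B \<circ> A)"
      using lin by (intro bounded_clinear_compose)
  next
    fix \<mu> x
    assume "(B \<circ> A) x = \<mu> *\<^sub>C x"
    then have x: "B (A x) = \<mu> *\<^sub>C x"
      by simp
    then show "(A \<circ> C) ((A \<circ> B \<circ> A) x) = \<mu> *\<^sub>C (A \<circ> B \<circ> A) x"
      using ABABA[of x] by (simp add: scale)
    assume "\<mu> \<noteq> 0" and "(A \<circ> B \<circ> A) x = 0"
    then have "B (A (B (A x))) = 0"
      by (simp add: zero)
    then show "x = 0"
      using \<open>\<mu> \<noteq> 0\<close> x by (simp add: scale scaleC_eq_0_iff)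
  qed

  show ?thesis
    unfolding SVEP_def using AC BA by blast
qed

end
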